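(* For any configuration $G$ with $n$ nodes and span $\sigma$, if $G$ is feasible then there is a dedicated distributed leader election algorithm $(D,f)$ for $G$ in which every node terminates within $O(n^2\sigma)$ rounds.
   Context: Model. A configuration is a finite simple undirected connected graph $G$ in which each node $v$ is tagged with a non-negative integer $t_v$ (its wakeup tag); by convention the smallest tag is $0$, and the span $\sigma$ of $G$ is the largest tag. Nodes are anonymous and communicate in synchronous global rounds. A node $v$ wakes up in the first global round $r\le t_v$ in which it receives a message, if any (forced wakeup), and otherwise in global round $t_v$ (spontaneous wakeup). Its local clock is $0$ in its wakeup round; it acts from local round $1$ on, and nodes do not know the global clock. In each round a node either transmits a message to all neighbours, listens, or terminates. A listening node $v$ receives message $M$ if exactly one neighbour transmits (and it transmits $M$), hears a collision (noise, distinguishable from silence and from messages) if at least two neighbours transmit, and hears silence otherwise; a transmitting node hears nothing. The history of $v$ in local round $i\ge 0$ is $\mathcal H_v[i]=(\emptyset)$ if $v$ transmits or hears silence in local round $i$ (or $i=0$ and $v$ woke up spontaneously), $(M)$ if $v$ receives $M$ in local round $i$ (or $i=0$ and $v$ was woken by $M$), and $( * )$ if a collision occurs at a listening $v$. A DRIP (distributed radio interaction protocol) is a function $D$ mapping finite history vectors to one of $\mathit{listen}$, $\mathit{transmit}(M)$, $\mathit{terminate}$; each node $v$ in local round $i\ge1$ performs $D(\mathcal H_v[0\ldots i-1])$, and every node must eventually terminate permanently. $done_v$ is the first local round in which $v$ terminates. A decision function $f$ maps the final history $\mathcal H_v[0\ldots done_v]$ to $\{0,1\}$. A dedicated leader election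 algorithm for $G$ is a pair $(D,f)$ such that, when all nodes of $G$ execute $D$, $f$ outputs $1$ at exactly one node. $G$ is feasible if such an algorithm exists.
   Formalization: The bound is proved as c·n²·(σ+1) with an absolute constant c; the +1 is needed only for σ = 0, where the one-node configuration is feasible but needs at least one round, so c·n²·σ = 0 fails; for σ ≥ 1 it is O(n²σ). *)

theory Defs
  imports Main
begin

text \<open>Radio network model. Nodes are natural numbers (names are invisible to the
protocol: a DRIP only sees histories). Messages are natural numbers (any finite
message can be encoded).\<close>

datatype hentry = Silence | Msg nat | Noise

datatype action = Listen | Transmit nat | Terminate

type_synonym drip = "hentry list \<Rightarrow> action"

definition configuration :: "nat set \<Rightarrow> (nat \<Rightarrow> nat \<Rightarrow> bool) \<Rightarrow> (nat \<Rightarrow> nat) \<Rightarrow> bool" where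
  "configuration V E t \<longleftrightarrow>
     finite V \<and> V \<noteq> {} \<and>
     (\<forall>u v. E u v \<longrightarrow> u \<in> V \<and> v \<in> V) \<and>
     (\<forall>u v. E u v \<longrightarrow> E v u) \<and>
     (\<forall>v. \<not> E v v) \<and>
     (\<forall>u\<in>V. \<forall>v\<in>V. E\<^sup>*\<^sup>* u v) \<and>
     (\<exists>v\<in>V. t v = 0)"

definition span :: "nat set \<Rightarrow> (nat \<Rightarrow> nat) \<Rightarrow> nat" where
  "span V t = Max (t ` V)"

text \<open>State of a node at the end of a global round: asleep, awake (woken in global
round w, history H = entries of local rounds 0..current), or terminated (final
history H = entries of local rounds 0..done).\<close>
datatype nstate = Asleep | Active nat "hentry list" | Done nat "hentry list"

definition msg_of :: "drip \<Rightarrow> nstate \<Rightarrow> nat option" where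
  "msg_of D s = (case s of Active w H \<Rightarrow> (case D H of Transmit M \<Rightarrow> Some M | _ \<Rightarrow> None)
                          | _ \<Rightarrow> None)"

definition reception :: "nat set \<Rightarrow> (nat \<Rightarrow> nat \<Rightarrow> bool) \<Rightarrow> drip \<Rightarrow> (nat \<Rightarrow> nstate) \<Rightarrow> nat \<Rightarrow> hentry" where
  "reception V E D s v =
     (let T = {u \<in> V. E v u \<and> msg_of D (s u) \<noteq> None} in
      if T = {} then Silence
      else if card T = 1 then Msg (the (msg_of D (s (THE u. u \<in> T))))
      else Noise)"

definition step :: "nat set \<Rightarrow> (nat \<Rightarrow> nat \<Rightarrow> bool) \<Rightarrow> (nat \<Rightarrow> nat) \<Rightarrow> drip \<Rightarrow> nat
                    \<Rightarrow> (nat \<Rightarrow> nstate) \<Rightarrow> (nat \<Rightarrow> nstate)" where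
  "step V E t D r s = (\<lambda>v.
     let h = reception V E D s v in
     (case s v of
        Asleep \<Rightarrow> (case h of
                     Msg M \<Rightarrow> (if r \<le> t v then Active r [Msg M]
                                else if r = t v then Active r [Silence] else Asleep)
                   | _ \<Rightarrow> (if r = t v then Active r [Silence] else Asleep))
      | Active w H \<Rightarrow> (case D H of
                        Transmit M \<Rightarrow> Active w (H @ [Silence])
                      | Listen \<Rightarrow> Active w (H @ [h])
                      | Terminate \<Rightarrow> Done w (H @ [h]))
      | Done w H \<Rightarrow> Done w H))"

fun run :: "nat set \<Rightarrow> (nat \<Rightarrow> nat \<Rightarrow> bool) \<Rightarrow> (nat \<Rightarrow> nat) \<Rightarrow> drip \<Rightarrow> nat \<Rightarrow> (nat \<Rightarrow> nstate)" where
  "run V E t D 0 = step V E t D 0 (\<lambda>_. Asleep)"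
| "run V E t D (Suc r) = step V E t D (Suc r) (run V E t D r)"

definition terminates :: "nat set \<Rightarrow> (nat \<Rightarrow> nat \<Rightarrow> bool) \<Rightarrow> (nat \<Rightarrow> nat) \<Rightarrow> drip \<Rightarrow> nat \<Rightarrow> bool" where
  "terminates V E t D v \<longleftrightarrow> (\<exists>r w H. run V E t D r v = Done w H)"

definition final_hist :: "nat set \<Rightarrow> (nat \<Rightarrow> nat \<Rightarrow> bool) \<Rightarrow> (nat \<Rightarrow> nat) \<Rightarrow> drip \<Rightarrow> nat \<Rightarrow> hentry list" where
  "final_hist V E t D v = (THE H. \<exists>r w. run V E t D r v = Done w H)"

definition done_round :: "nat set \<Rightarrow> (nat \<Rightarrow> nat \<Rightarrow> bool) \<Rightarrow> (nat \<Rightarrow> nat) \<Rightarrow> drip \<Rightarrow> nat \<Rightarrow> nat" where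
  "done_round V E t D v = length (final_hist V E t D v) - 1"

definition dedicated_LE :: "nat set \<Rightarrow> (nat \<Rightarrow> nat \<Rightarrow> bool) \<Rightarrow> (nat \<Rightarrow> nat) \<Rightarrow> drip
                            \<Rightarrow> (hentry list \<Rightarrow> bool) \<Rightarrow> bool" where
  "dedicated_LE V E t D f \<longleftrightarrow>
     (\<forall>v\<in>V. terminates V E t D v) \<and>
     card {v \<in> V. f (final_hist V E t D v)} = 1"

definition feasible :: "nat set \<Rightarrow> (nat \<Rightarrow> nat \<Rightarrow> bool) \<Rightarrow> (nat \<Rightarrow> nat) \<Rightarrow> bool" where
  "feasible V E t \<longleftrightarrow> (\<exists>D f. dedicated_LE V E t D f)"

end

theory Submission
  imports Defs
begin

text \<open>Colour the nodes and call the colouring balanced if equally coloured nodes have, up to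
  the cap "none, one, several", equally many neighbours of each colour at each tag offset. Under
  any protocol, equally coloured nodes of a balanced colouring have the same history up to a
  shift of time by their tags, so a leader must have a colour of its own. Conversely, colour the
  nodes by their histories under a protocol that keeps silent until everybody is awake. If this is
  not balanced, two equally coloured nodes see different numbers of neighbours of some colour
  \<open>C\<close> at some offset; appending a block of \<open>2 * span V t + 1\<close> rounds in whose middle the nodes of
  colour \<open>C\<close> transmit separates them. After fewer than \<open>card V\<close> blocks the colouring is balanced,
  and the history of the leader identifies it.\<close>

text \<open>The old colouring \<open>g\<close> factors through the new one \<open>f\<close> via
  \<open>h\<close>, and \<open>h\<close> merges \<open>f u\<close> with \<open>f v\<close>, so it is
  not injective on the new colours.\<close>

lemma card_image_less_refine:
  assumes "finite A" and ref: "\<And>x. x \<in> A \<Longrightarrow> g x = h (f x)"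
    and "u \<in> A" "v \<in> A" "g u = g v" "f u \<noteq> f v"
  shows "card (g ` A) < card (f ` A)"
proof -
  have img: "g ` A = h ` f ` A" using ref by force
  have "\<not> inj_on h (f ` A)"
    using assms by (auto simp: inj_on_def)
  then show ?thesis
    unfolding img using assms(1)
    by (metis card_image_le eq_card_imp_inj_on finite_imageI le_neq_implies_less)
qed

section \<open>Receptions in terms of transmitting neighbours\<close>

locale radio_network =
  fixes V :: "nat set" and E :: "nat \<Rightarrow> nat \<Rightarrow> bool" and t :: "nat \<Rightarrow> nat"
  assumes config: "configuration V E t"
begin

lemma finite_V: "finite V" and V_nonempty: "V \<noteq> {}"
  using config by (auto simp: configuration_def)

lemma tag_le_span: "v \<in> V \<Longrightarrow> t v \<le> span V t"
  using finite_V by (simp add: span_def)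

definition transmitters :: "drip \<Rightarrow> (nat \<Rightarrow> nstate) \<Rightarrow> nat \<Rightarrow> nat set" where
  "transmitters D s v = {u \<in> V. E v u \<and> msg_of D (s u) \<noteq> None}"

lemma finite_transmitters: "finite (transmitters D s v)"
  using finite_V by (simp add: transmitters_def)

lemma reception_eq:
  "reception V E D s v =
    (if transmitters D s v = {} then Silence
     else if card (transmitters D s v) = 1
       then Msg (the (msg_of D (s (THE u. u \<in> transmitters D s v))))
     else Noise)"
  by (simp add: reception_def transmitters_def Let_def)

lemma reception_Silence: "transmitters D s v = {} \<Longrightarrow> reception V E D s v = Silence"
  by (simp add: reception_eq)

lemma reception_Msg: "transmitters D s v = {u} \<Longrightarrow> reception V E D s v = Msg (the (msg_of D (s u)))"
  by (simp add: reception_eq)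

lemma reception_Noise:
  assumes "u \<in> transmitters D s v" "w \<in> transmitters D s v" "u \<noteq> w"
  shows "reception V E D s v = Noise"
proof -
  have "card (transmitters D s v) \<noteq> 1"
    using assms by (auto simp: card_1_singleton_iff)
  then show ?thesis using assms by (auto simp: reception_eq)
qed

text \<open>Compares transmitters up to the cap of two: \<open>w1 = w2\<close> demands one with the
  same message near \<open>v\<close>, and \<open>w1 \<noteq> w2\<close> demands two.\<close>

definition dominated :: "drip \<Rightarrow> (nat \<Rightarrow> nstate) \<Rightarrow> nat \<Rightarrow> (nat \<Rightarrow> nstate) \<Rightarrow> nat \<Rightarrow> bool" where
  "dominated D s u s' v \<longleftrightarrow>
    (\<forall>w1 \<in> transmitters D s u. \<forall>w2 \<in> transmitters D s u.
      \<exists>x1 \<in> transmitters D s' v. \<exists>x2 \<in> transmitters D s' v.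
        msg_of D (s' x1) = msg_of D (s w1) \<and> (w1 \<noteq> w2 \<longrightarrow> x1 \<noteq> x2))"

lemma reception_cong:
  assumes uv: "dominated D s u s' v" and vu: "dominated D s' v s u"
  shows "reception V E D s u = reception V E D s' v"
proof (cases "\<exists>w1 \<in> transmitters D s u. \<exists>w2 \<in> transmitters D s u. w1 \<noteq> w2")
  case True
  then obtain w1 w2 where w: "w1 \<in> transmitters D s u" "w2 \<in> transmitters D s u" "w1 \<noteq> w2"
    by blast
  with uv obtain x1 x2 where "x1 \<in> transmitters D s' v" "x2 \<in> transmitters D s' v" "x1 \<noteq> x2"
    unfolding dominated_def by metis
  with w show ?thesis by (simp add: reception_Noise)
next
  case False
  have sub: "x1 = x2" if "x1 \<in> transmitters D s' v" "x2 \<in> transmitters D s' v" for x1 x2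
    using that vu False unfolding dominated_def by metis
  show ?thesis
  proof (cases "transmitters D s u = {}")
    case True
    then have "transmitters D s' v = {}" using vu unfolding dominated_def by blast
    with True show ?thesis by (simp add: reception_Silence)
  next
    case ne: False
    then obtain w where w: "w \<in> transmitters D s u" by blast
    with uv obtain x where x: "x \<in> transmitters D s' v" "msg_of D (s' x) = msg_of D (s w)"
      unfolding dominated_def by metis
    have "transmitters D s u = {w}" using w False by blast
    moreover have "transmitters D s' v = {x}" using x sub by blast
    ultimately show ?thesis using x by (simp add: reception_Msg)
  qed
qed

section \<open>Balanced colourings\<close>

definition nbrs :: "(nat \<Rightarrow> 'a) \<Rightarrow> 'a \<Rightarrow> int \<Rightarrow> nat \<Rightarrow> nat set" where
  "nbrs c C d v = {w \<in> V. E v w \<and> c w = C \<and> int (t w) = int (t v) + d}"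

text \<open>The exempt pair: neighbours of the same colour and tag as \<open>u\<close> transmit only when
  \<open>u\<close> does, so \<open>u\<close> never hears them. Counts are capped at two since a collision does not
  reveal how many neighbours transmit.\<close>

definition balanced :: "(nat \<Rightarrow> 'a) \<Rightarrow> bool" where
  "balanced c \<longleftrightarrow> (\<forall>u \<in> V. \<forall>v \<in> V. c u = c v \<longrightarrow>
    (\<forall>C d. \<not> (C = c u \<and> d = 0) \<longrightarrow> min 2 (card (nbrs c C d u)) = min 2 (card (nbrs c C d v))))"

lemma finite_nbrs: "finite (nbrs c C d v)"
  using finite_V by (simp add: nbrs_def)

text \<open>A positive capped count yields a partner, a capped count of two yields a second one;
  partners from different classes differ because the classes at \<open>v\<close> are
  disjoint.\<close>

lemma balanced_pair:
  assumes bal: "balanced c" and uv: "u \<in> V" "v \<in> V" "c u = c v"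
    and w1: "w1 \<in> nbrs c C1 d1 u" "\<not> (C1 = c u \<and> d1 = 0)"
    and w2: "w2 \<in> nbrs c C2 d2 u" "\<not> (C2 = c u \<and> d2 = 0)"
  shows "\<exists>x1 \<in> nbrs c C1 d1 v. \<exists>x2 \<in> nbrs c C2 d2 v. w1 \<noteq> w2 \<longrightarrow> x1 \<noteq> x2"
proof -
  have cnt: "min 2 (card (nbrs c C d u)) = min 2 (card (nbrs c C d v))"
    if "\<not> (C = c u \<and> d = 0)" for C d
    using bal uv that unfolding balanced_def by blast
  have ex: "\<exists>x. x \<in> nbrs c C d v" if "w \<in> nbrs c C d u" "\<not> (C = c u \<and> d = 0)" for w C d
  proof -
    have "card (nbrs c C d u) > 0" using that(1) finite_nbrs[of c C d u] by (auto simp: card_gt_0_iff)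
    with cnt[OF that(2)] have "card (nbrs c C d v) > 0" by (auto simp: min_def split: if_splits)
    then show ?thesis by (auto simp: card_gt_0_iff)
  qed
  from ex w1 obtain x1 where x1: "x1 \<in> nbrs c C1 d1 v" by blast
  from ex w2 obtain x2 where x2: "x2 \<in> nbrs c C2 d2 v" by blast
  show ?thesis
  proof (cases "C1 = C2 \<and> d1 = d2 \<and> w1 \<noteq> w2")
    case True
    then have "card {w1, w2} \<le> card (nbrs c C1 d1 u)"
      using w1 w2 by (intro card_mono finite_nbrs) auto
    with True cnt[OF w1(2)] have "card (nbrs c C1 d1 v) \<ge> 2" by (auto simp: min_def split: if_splits)
    then obtain y where "y \<in> nbrs c C1 d1 v" "y \<noteq> x1"
      by (metis One_nat_def card_le_Suc0_iff_eq finite_nbrs not_less_eq_eq numeral_2_eq_2 x1)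
    with True x1 show ?thesis by blast
  next
    case False
    moreover have "x1 \<noteq> x2" if "\<not> (C1 = C2 \<and> d1 = d2)"
      using x1 x2 that by (auto simp: nbrs_def)
    ultimately show ?thesis using x1 x2 by blast
  qed
qed

section \<open>Nodes of equal colour are indistinguishable\<close>

text \<open>The wakeup round is the only part of a state that refers to global time.\<close>

fun erase :: "nstate \<Rightarrow> nstate" where
  "erase Asleep = Asleep"
| "erase (Active w H) = Active 0 H"
| "erase (Done w H) = Done 0 H"

text \<open>Rounds range over the integers, so that histories of nodes with different tags can be
  compared after a shift of time that may lead before round 0.\<close>

definition state_at :: "drip \<Rightarrow> int \<Rightarrow> nat \<Rightarrow> nstate" where
  "state_at D g v = (if g < 0 then Asleep else run V E t D (nat g) v)"

text \<open>Here \<open>d\<close> is the global round minus the tag, the only way in which time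
  enters a step on erased states.\<close>

fun next_state :: "drip \<Rightarrow> int \<Rightarrow> nstate \<Rightarrow> hentry \<Rightarrow> nstate" where
  "next_state D d Asleep h = (case h of
      Msg M \<Rightarrow> (if d \<le> 0 then Active 0 [Msg M] else Asleep)
    | _ \<Rightarrow> (if d = 0 then Active 0 [Silence] else Asleep))"
| "next_state D d (Active w H) h = (case D H of
      Transmit M \<Rightarrow> Active 0 (H @ [Silence])
    | Listen \<Rightarrow> Active 0 (H @ [h])
    | Terminate \<Rightarrow> Done 0 (H @ [h]))"
| "next_state D d (Done w H) h = Done 0 H"

lemma msg_of_erase: "msg_of D (erase s) = msg_of D s"
  by (cases s) (auto simp: msg_of_def)

lemma msg_of_Asleep [simp]: "msg_of D Asleep = None"
  by (simp add: msg_of_def)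

lemma erase_step:
  "erase (step V E t D r s v)
    = next_state D (int r - int (t v)) (erase (s v)) (reception V E D s v)"
  by (cases "s v") (auto simp: step_def Let_def split: hentry.splits action.splits)

lemma erase_state_at:
  "erase (state_at D g v) = next_state D (g - int (t v)) (erase (state_at D (g - 1) v))
     (reception V E D (state_at D (g - 1)) v)"
proof -
  consider "g < 0" | "g = 0" | "g > 0" by linarith
  then show ?thesis
  proof cases
    case 1
    then show ?thesis
      by (simp add: state_at_def reception_Silence transmitters_def)
  next
    case 2
    then have "state_at D (g - 1) = (\<lambda>_. Asleep)" by (auto simp: state_at_def)
    then show ?thesis using 2 erase_step[of D 0 "\<lambda>_. Asleep" v] by (simp add: state_at_def)
  next
    case 3
    define k where "k = nat (g - 1)"
    have g: "nat g = Suc k" "g = int (Suc k)" using 3 by (auto simp: k_def)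
    have prev: "state_at D (g - 1) = run V E t D k"
      using 3 by (auto simp: state_at_def k_def)
    show ?thesis
      unfolding prev using erase_step[of D "Suc k" "run V E t D k" v] 3 g
      by (simp add: state_at_def)
  qed
qed

lemma next_state_transmit: "msg_of D s \<noteq> None \<Longrightarrow> next_state D d s h = next_state D d s h'"
  by (cases s) (auto simp: msg_of_def split: action.splits)

text \<open>The induction is on a bound \<open>k\<close> for the global rounds, not on
  \<open>d\<close>: a neighbour with a smaller tag has a larger offset from its own tag, yet
  corresponding neighbours of \<open>u\<close> and \<open>v\<close> are always compared one global
  round earlier.\<close>

lemma balanced_indistinguishable:
  assumes bal: "balanced c"
  shows "\<lbrakk>u \<in> V; v \<in> V; c u = c v; int (t u) + d < int k; int (t v) + d < int k\<rbrakk>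
    \<Longrightarrow> erase (state_at D (int (t u) + d) u) = erase (state_at D (int (t v) + d) v)"
proof (induction k arbitrary: u v d)
  case 0
  then show ?case by (simp add: state_at_def)
next
  case (Suc k)
  let ?su = "state_at D (int (t u) + d - 1)" and ?sv = "state_at D (int (t v) + d - 1)"
  have same: "erase (?su u) = erase (?sv v)"
    using Suc.IH[of u v "d - 1"] Suc.prems by (simp add: algebra_simps)
  have dom: "dominated D (state_at D (int (t a) + d - 1)) a (state_at D (int (t b) + d - 1)) b"
    if a: "a \<in> V" and b: "b \<in> V" and ab: "c a = c b"
      and ka: "int (t a) + d \<le> int k" and kb: "int (t b) + d \<le> int k"
      and quiet: "msg_of D (state_at D (int (t a) + d - 1) a) = None"
    for a b
  proof -
    let ?sa = "state_at D (int (t a) + d - 1)" and ?sb = "state_at D (int (t b) + d - 1)"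
    \<comment> \<open>A neighbour with the colour and tag of \<open>a\<close> is, by induction, in
      the same state as the silent \<open>a\<close>; so no transmitter lies in the exempt
      class.\<close>
    have loud: "w \<in> nbrs c (c w) (int (t w) - int (t a)) a \<and>
        \<not> (c w = c a \<and> int (t w) - int (t a) = 0)"
      if w: "w \<in> transmitters D ?sa a" for w
    proof -
      have wV: "w \<in> V" "E a w" "msg_of D (?sa w) \<noteq> None" using w by (auto simp: transmitters_def)
      have False if "c w = c a" "t w = t a"
      proof -
        have "erase (?sa w) = erase (?sa a)"
          using Suc.IH[of w a "d - 1"] that wV a ka by (simp add: algebra_simps)
        then show False using wV quiet by (metis msg_of_erase)
      qed
      then show ?thesis using wV by (auto simp: nbrs_def)
    qed
    have answer: "x \<in> transmitters D ?sb b \<and> msg_of D (?sb x) = msg_of D (?sa w)"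
      if w: "w \<in> transmitters D ?sa a"
        and x: "x \<in> nbrs c (c w) (int (t w) - int (t a)) b" for w x
    proof -
      have wV: "w \<in> V" "msg_of D (?sa w) \<noteq> None" using w by (auto simp: transmitters_def)
      have xV: "x \<in> V" "E b x" "c x = c w" "int (t x) = int (t b) + (int (t w) - int (t a))"
        using x by (auto simp: nbrs_def)
      have "erase (?sb x) = erase (?sa w)"
        using Suc.IH[of x w "int (t a) + d - 1 - int (t w)"] wV xV ka kb
        by (simp add: algebra_simps)
      then have "msg_of D (?sb x) = msg_of D (?sa w)" by (metis msg_of_erase)
      then show ?thesis using wV xV by (simp add: transmitters_def)
    qed
    show ?thesis
      unfolding dominated_def
    proof (intro ballI)
      fix w1 w2 assume w: "w1 \<in> transmitters D ?sa a" "w2 \<in> transmitters D ?sa a"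
      obtain x1 x2 where "x1 \<in> nbrs c (c w1) (int (t w1) - int (t a)) b"
        "x2 \<in> nbrs c (c w2) (int (t w2) - int (t a)) b" "w1 \<noteq> w2 \<longrightarrow> x1 \<noteq> x2"
        using balanced_pair[OF bal a b ab] loud[OF w(1)] loud[OF w(2)] by blast
      then show "\<exists>x1 \<in> transmitters D ?sb b. \<exists>x2 \<in> transmitters D ?sb b.
          msg_of D (?sb x1) = msg_of D (?sa w1) \<and> (w1 \<noteq> w2 \<longrightarrow> x1 \<noteq> x2)"
        using answer w by blast
    qed
  qed
  have "next_state D d (erase (?su u)) (reception V E D ?su u)
      = next_state D d (erase (?sv v)) (reception V E D ?sv v)"
  proof (cases "msg_of D (erase (?su u)) = None")
    case True
    then have "msg_of D (?su u) = None" "msg_of D (?sv v) = None"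
      using same by (metis msg_of_erase)+
    then have "reception V E D ?su u = reception V E D ?sv v"
      using Suc.prems by (intro reception_cong dom) auto
    then show ?thesis using same by simp
  next
    case False
    \<comment> \<open>A transmitting node hears nothing, so a difference in what neighbours send has
      no effect here.\<close>
    then show ?thesis using same next_state_transmit by metis
  qed
  then show ?case
    by (subst (1 2) erase_state_at) simp
qed

lemma run_Done_mono:
  assumes "run V E t D r v = Done w H"
  shows "run V E t D (r + k) v = Done w H"
proof (induction k)
  case (Suc k)
  then show ?case by (simp add: step_def)
qed (simp add: assms)

lemma final_hist_eqI:
  assumes "run V E t D r v = Done w H"
  shows "final_hist V E t D v = H"
  unfolding final_hist_def
proof (rule the_equality)
  show "\<exists>r w. run V E t D r v = Done w H" using assms by blast
next
  fix H' assume "\<exists>r w. run V E t D r v = Done w H'"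
  then obtain r' w' where "run V E t D r' v = Done w' H'" by blast
  with run_Done_mono[OF assms, of r'] run_Done_mono[OF this, of r] show "H' = H"
    by (simp add: add.commute)
qed

lemma balanced_final_hist_eq:
  assumes "balanced c" "u \<in> V" "v \<in> V" "c u = c v" "terminates V E t D u"
  shows "final_hist V E t D u = final_hist V E t D v"
proof -
  obtain r w H where r: "run V E t D r u = Done w H"
    using assms by (auto simp: terminates_def)
  define d where "d = int r - int (t u)"
  define g where "g = int (t v) + d"
  have "erase (state_at D (int (t u) + d) u) = erase (state_at D g v)"
    unfolding g_def using assms
    by (intro balanced_indistinguishable[OF assms(1), where k = "Suc (nat (max (int (t u) + d) (int (t v) + d)))"])
      auto
  moreover have "state_at D (int (t u) + d) u = Done w H"
    using r by (simp add: d_def state_at_def)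
  ultimately have "erase (state_at D g v) = Done 0 H" by simp
  then obtain w' where "state_at D g v = Done w' H"
    by (cases "state_at D g v") auto
  then have "run V E t D (nat g) v = Done w' H"
    by (auto simp: state_at_def split: if_splits)
  then show ?thesis using r by (simp add: final_hist_eqI)
qed

section \<open>Patient protocols\<close>

text \<open>No node transmits before every node has woken up, and transmissions stop early enough for
  every node to hear them within its first \<open>L\<close> history entries.\<close>

definition patient :: "drip \<Rightarrow> nat \<Rightarrow> bool" where
  "patient D L \<longleftrightarrow> L > 0 \<and>
    (\<forall>H. D H = Listen \<or> (D H = Transmit 0 \<and> span V t < length H \<and> length H + span V t < L))"

text \<open>The index \<open>i\<close> is the local round, so there are \<open>Suc i\<close>
  entries; under a patient protocol the default \<open>[]\<close> never occurs for nodes of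
  \<open>V\<close>.\<close>

definition hist :: "drip \<Rightarrow> nat \<Rightarrow> nat \<Rightarrow> hentry list" where
  "hist D v i = (case run V E t D (t v + i) v of Active w H \<Rightarrow> H | _ \<Rightarrow> [])"

lemma step_spontaneous:
  assumes "s v = Asleep" "transmitters D s v = {}"
  shows "step V E t D r s v = (if r = t v then Active r [Silence] else Asleep)"
  using assms by (simp add: step_def reception_Silence)

text \<open>While some node sleeps, every awake node has at most \<open>span V t\<close> history
  entries and so listens; hence no wakeup is forced.\<close>

lemma patient_run:
  assumes p: "patient D L"
  shows "v \<in> V \<Longrightarrow> (r < t v \<longrightarrow> run V E t D r v = Asleep) \<and>
    (t v \<le> r \<longrightarrow> (\<exists>H. run V E t D r v = Active (t v) H \<and> length H = Suc (r - t v)))"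
proof (induction r arbitrary: v)
  case 0
  have "run V E t D 0 v = (if 0 = t v then Active 0 [Silence] else Asleep)"
    by (simp add: step_spontaneous transmitters_def)
  then show ?case by auto
next
  case (Suc r)
  show ?case
  proof (cases "t v \<le> r")
    case True
    with Suc obtain H where "run V E t D r v = Active (t v) H" "length H = Suc (r - t v)" by blast
    moreover have "D H \<noteq> Terminate" using p unfolding patient_def by (metis action.distinct(3,5))
    ultimately show ?thesis using True
      by (auto simp: step_def Let_def split: action.splits)
  next
    case False
    with Suc have asleep: "run V E t D r v = Asleep" by simp
    have quiet: "msg_of D (run V E t D r w) = None" if w: "w \<in> V" for w
    proof (cases "t w \<le> r")
      case True
      with Suc.IH[OF w] obtain H where H: "run V E t D r w = Active (t w) H" "length H \<le> Suc r"
        by auto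
      have "length H \<le> span V t" using H False tag_le_span[OF Suc.prems] by linarith
      then have "D H = Listen" using p unfolding patient_def by (metis leD)
      with H show ?thesis by (simp add: msg_of_def)
    next
      case False
      with Suc.IH[OF w] show ?thesis by simp
    qed
    then have "transmitters D (run V E t D r) v = {}" by (auto simp: transmitters_def)
    with asleep False show ?thesis by (auto simp: step_spontaneous)
  qed
qed

lemma patient_run_hist:
  assumes "patient D L" "v \<in> V" "t v \<le> r"
  shows "run V E t D r v = Active (t v) (hist D v (r - t v))"
  using patient_run[OF assms(1,2), of r] assms(3) by (auto simp: hist_def)

lemma patient_run_Asleep:
  assumes "patient D L" "v \<in> V" "r < t v"
  shows "run V E t D r v = Asleep"
  using patient_run[OF assms(1,2), of r] assms(3) by auto

lemma length_hist:
  assumes "patient D L" "v \<in> V"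
  shows "length (hist D v i) = Suc i"
  using patient_run[OF assms, of "t v + i"] by (auto simp: hist_def)

lemma hist_Suc:
  assumes p: "patient D L" and v: "v \<in> V"
  shows "hist D v (Suc i) = hist D v i @
    [if D (hist D v i) = Listen then reception V E D (run V E t D (t v + i)) v else Silence]"
proof -
  have "D (hist D v i) \<noteq> Terminate" using p unfolding patient_def by (metis action.distinct(3,5))
  then show ?thesis
    using patient_run_hist[OF p v, of "t v + i"]
    by (auto simp: hist_def[of D v "Suc i"] step_def Let_def split: action.splits)
qed

lemma take_hist:
  assumes p: "patient D L" and v: "v \<in> V"
  shows "i \<le> j \<Longrightarrow> take (Suc i) (hist D v j) = hist D v i"
proof (induction j)
  case 0
  then show ?case using length_hist[OF p v, of 0] by simp
next
  case (Suc j)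
  show ?case
  proof (cases "i = Suc j")
    case True
    then show ?thesis using length_hist[OF p v, of "Suc j"] by simp
  next
    case False
    then have "i \<le> j" using Suc.prems by simp
    moreover have "take (Suc i) (hist D v (Suc j)) = take (Suc i) (hist D v j)"
      using \<open>i \<le> j\<close> length_hist[OF p v, of j] by (simp add: hist_Suc[OF p v, of j])
    ultimately show ?thesis using Suc.IH by simp
  qed
qed

lemma hist_nth_Suc:
  assumes p: "patient D L" and v: "v \<in> V" and "i < j"
  shows "hist D v j ! Suc i =
    (if D (hist D v i) = Listen then reception V E D (run V E t D (t v + i)) v else Silence)"
proof -
  have "hist D v j ! Suc i = hist D v (Suc i) ! Suc i"
    using take_hist[OF p v, of "Suc i" j] assms(3) by (metis Suc_leI lessI nth_take)
  then show ?thesis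
    using length_hist[OF p v, of i] by (simp add: hist_Suc[OF p v] nth_append)
qed

lemma transmitters_patient:
  assumes p: "patient D L"
  shows "transmitters D (run V E t D r) v =
    {w \<in> V. E v w \<and> t w \<le> r \<and> D (hist D w (r - t w)) \<noteq> Listen}"
proof -
  have "msg_of D (run V E t D r w) \<noteq> None \<longleftrightarrow> t w \<le> r \<and> D (hist D w (r - t w)) \<noteq> Listen"
    if "w \<in> V" for w
  proof (cases "t w \<le> r")
    case True
    moreover have "D (hist D w (r - t w)) \<noteq> Terminate"
      using p unfolding patient_def by (metis action.distinct(3,5))
    ultimately show ?thesis
      using patient_run_hist[OF p that, of r] by (auto simp: msg_of_def split: action.splits)
  next
    case False
    then show ?thesis using patient_run_Asleep[OF p that, of r] by simp
  qed
  then show ?thesis by (auto simp: transmitters_def)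
qed

text \<open>Patient protocols send no message but 0, so the number of transmitting neighbours
  determines the reception.\<close>

definition heard :: "nat \<Rightarrow> hentry" where
  "heard n = (if n = 0 then Silence else if n = 1 then Msg 0 else Noise)"

lemma heard_eq_iff: "heard m = heard n \<longleftrightarrow> min 2 m = min 2 n"
  by (auto simp: heard_def min_def)

lemma reception_patient:
  assumes p: "patient D L"
  shows "reception V E D s v = heard (card (transmitters D s v))"
proof -
  have "the (msg_of D (s u)) = 0" if "msg_of D (s u) \<noteq> None" for u
  proof -
    obtain w H where "s u = Active w H" "D H \<noteq> Listen"
      using \<open>msg_of D (s u) \<noteq> None\<close> by (auto simp: msg_of_def split: nstate.splits action.splits)
    moreover from this have "D H = Transmit 0" using p unfolding patient_def by blast
    ultimately show ?thesis by (simp add: msg_of_def)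
  qed
  moreover have "msg_of D (s u) \<noteq> None" if "transmitters D s v = {u}" for u
    using that by (auto simp: transmitters_def)
  ultimately show ?thesis
    using finite_transmitters[of D s v]
    by (auto simp: reception_eq heard_def card_1_singleton_iff)
qed

section \<open>Appending a block that separates two nodes\<close>

text \<open>The colour \<open>C\<close> is a history of \<open>L\<close> entries. The block covers
  local rounds \<open>L\<close> to \<open>L + 2 * span V t\<close>, with room for every tag offset
  on either side of the transmission.\<close>

definition extend :: "drip \<Rightarrow> nat \<Rightarrow> hentry list \<Rightarrow> drip" where
  "extend D L C H =
    (if length H < L then D H
     else if length H = L + span V t \<and> take L H = C then Transmit 0 else Listen)"

lemma patient_extend:
  assumes "patient D L"
  shows "patient (extend D L C) (L + 2 * span V t + 1)"
  unfolding patient_def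
proof (intro conjI allI)
  fix H
  show "extend D L C H = Listen \<or> (extend D L C H = Transmit 0 \<and> span V t < length H \<and>
      length H + span V t < L + 2 * span V t + 1)"
  proof (cases "length H < L")
    case True
    moreover have "D H = Listen \<or> (D H = Transmit 0 \<and> span V t < length H)"
      using assms unfolding patient_def by blast
    ultimately show ?thesis by (auto simp: extend_def)
  next
    case False
    moreover have "L > 0" using assms by (simp add: patient_def)
    ultimately show ?thesis by (simp add: extend_def)
  qed
qed simp

text \<open>After global round \<open>r\<close> no history has more than \<open>r + 1\<close>
  entries, so before round \<open>k\<close> only histories on which the protocols agree are
  consulted.\<close>

lemma run_cong:
  assumes p: "patient D L" and p': "patient D' L'"
    and eq: "\<And>H. length H < k \<Longrightarrow> D H = D' H"
  shows "r < k \<Longrightarrow> v \<in> V \<Longrightarrow> run V E t D r v = run V E t D' r v"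
proof (induction r arbitrary: v)
  case 0
  show ?case by (simp add: step_spontaneous transmitters_def)
next
  case (Suc r)
  have msg: "msg_of D (run V E t D r w) = msg_of D' (run V E t D' r w)" if w: "w \<in> V" for w
  proof (cases "t w \<le> r")
    case True
    then have "length (hist D w (r - t w)) < k" using Suc.prems by (simp add: length_hist[OF p w])
    then show ?thesis
      using Suc patient_run_hist[OF p w True] eq w by (simp add: msg_of_def)
  next
    case False
    then show ?thesis using patient_run_Asleep[OF p w] patient_run_Asleep[OF p' w] by simp
  qed
  have state: "run V E t D r w = run V E t D' r w" if "w \<in> V" for w using Suc that by simp
  have tr: "transmitters D (run V E t D r) v = transmitters D' (run V E t D' r) v"
    using msg by (auto simp: transmitters_def)
  have rec: "reception V E D (run V E t D r) v = reception V E D' (run V E t D' r) v"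
    by (simp add: reception_patient[OF p] reception_patient[OF p'] tr)
  show ?case
  proof (cases "t v \<le> r")
    case True
    then have "D (hist D v (r - t v)) = D' (hist D v (r - t v))"
      using Suc.prems by (intro eq) (simp add: length_hist[OF p])
    then show ?thesis
      using state[OF Suc.prems(2), symmetric] patient_run_hist[OF p Suc.prems(2) True] rec
      by (simp add: step_def Let_def split: action.split)
  next
    case False
    then show ?thesis
      using patient_run_Asleep[OF p Suc.prems(2), of r] patient_run_Asleep[OF p' Suc.prems(2), of r] rec
      by (simp add: step_def)
  qed
qed

text \<open>The extension departs from \<open>D\<close> only at length \<open>L + span V t\<close>,
  while \<open>v\<close> completes its first \<open>L\<close> entries in global round
  \<open>t v + (L - 1)\<close>, which is earlier.\<close>

lemma take_hist_extend:
  assumes p: "patient D L" and v: "v \<in> V" and j: "L - 1 \<le> j"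
  shows "take L (hist (extend D L C) v j) = hist D v (L - 1)"
proof -
  let ?D = "extend D L C"
  note p' = patient_extend[OF p, of C]
  have L: "L > 0" using p by (simp add: patient_def)
  have eq: "D H = ?D H" if "length H < L + span V t" for H
  proof (cases "length H < L")
    case False
    then have "D H = Listen" using p unfolding patient_def by (metis add_lessD1)
    then show ?thesis using that False by (simp add: extend_def)
  qed (simp add: extend_def)
  have "t v + (L - 1) < L + span V t" using tag_le_span[OF v] L by linarith
  then have "run V E t D (t v + (L - 1)) v = run V E t ?D (t v + (L - 1)) v"
    using run_cong[OF p p' eq] v by blast
  then have "hist ?D v (L - 1) = hist D v (L - 1)" by (simp add: hist_def)
  moreover have "take L (hist ?D v j) = hist ?D v (L - 1)"
    using take_hist[OF p' v j] L by simp
  ultimately show ?thesis by simp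
qed

text \<open>A node of colour \<open>C\<close> transmits in its local round
  \<open>L + span V t\<close>, which is local round \<open>i\<close> of \<open>v\<close> exactly if
  its tag exceeds that of \<open>v\<close> by \<open>d\<close>. In the excluded case
  \<open>v\<close> itself transmits at that moment.\<close>

lemma hist_extend_nth:
  assumes p: "patient D L" and v: "v \<in> V" and d: "\<bar>d\<bar> \<le> int (span V t)"
    and i: "int i = int L + int (span V t) + d"
    and ne: "\<not> (C = hist D v (L - 1) \<and> d = 0)"
  shows "hist (extend D L C) v (L + 2 * span V t) ! i
    = heard (card (nbrs (\<lambda>w. hist D w (L - 1)) C d v))"
proof -
  let ?D = "extend D L C"
  note p' = patient_extend[OF p, of C]
  have L: "L > 0" using p by (simp add: patient_def)
  \<comment> \<open>The old protocol is silent from length \<open>L - span V t\<close> on, so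
    neighbours that lag behind \<open>v\<close> do not disturb the block.\<close>
  have acts: "?D (hist ?D w j) \<noteq> Listen \<longleftrightarrow> Suc j = L + span V t \<and> hist D w (L - 1) = C"
    if w: "w \<in> V" and j: "L \<le> Suc j + span V t" for w j
  proof (cases "Suc j < L")
    case True
    then have "D (hist ?D w j) = Listen"
      using p length_hist[OF p' w, of j] j unfolding patient_def by (metis leD)
    then show ?thesis using True by (simp add: extend_def length_hist[OF p' w])
  next
    case False
    then show ?thesis
      using take_hist_extend[OF p w, of j C] by (simp add: extend_def length_hist[OF p' w])
  qed
  obtain j where j: "i = Suc j" using i d L by (cases i) auto
  have "?D (hist ?D v j) = Listen"
    using acts[OF v, of j] i d j ne by auto
  moreover have "j < L + 2 * span V t" using i d j by auto
  ultimately have "hist ?D v (L + 2 * span V t) ! i = reception V E ?D (run V E t ?D (t v + j)) v"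
    using hist_nth_Suc[OF p' v] j by simp
  also have "\<dots> = heard (card (transmitters ?D (run V E t ?D (t v + j)) v))"
    by (rule reception_patient[OF p'])
  also have "transmitters ?D (run V E t ?D (t v + j)) v = nbrs (\<lambda>w. hist D w (L - 1)) C d v"
  proof -
    have "t w \<le> t v + j \<and> ?D (hist ?D w (t v + j - t w)) \<noteq> Listen \<longleftrightarrow>
        hist D w (L - 1) = C \<and> int (t w) = int (t v) + d" if w: "w \<in> V" for w
    proof (cases "t w \<le> t v + j")
      case True
      have "L \<le> Suc (t v + j - t w) + span V t"
        using True i j d tag_le_span[OF w] by linarith
      from acts[OF w this] True i j show ?thesis by auto
    next
      case False
      then show ?thesis using i j L by auto
    qed
    then show ?thesis by (auto simp: transmitters_patient[OF p'] nbrs_def)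
  qed
  finally show ?thesis .
qed

lemma unbalanced_extend:
  assumes p: "patient D L" and nb: "\<not> balanced (\<lambda>v. hist D v (L - 1))"
  shows "\<exists>D'. patient D' (L + 2 * span V t + 1) \<and>
    card ((\<lambda>v. hist D v (L - 1)) ` V) < card ((\<lambda>v. hist D' v (L + 2 * span V t)) ` V)"
proof -
  let ?c = "\<lambda>v. hist D v (L - 1)"
  obtain u v C d where uv: "u \<in> V" "v \<in> V" "?c u = ?c v" and ne: "\<not> (C = ?c u \<and> d = 0)"
    and neq: "min 2 (card (nbrs ?c C d u)) \<noteq> min 2 (card (nbrs ?c C d v))"
    using nb unfolding balanced_def by blast
  \<comment> \<open>Two different counts are not both zero, so some pair of nodes realises the
    offset \<open>d\<close>, which is therefore within the span.\<close>
  have "nbrs ?c C d u \<noteq> {} \<or> nbrs ?c C d v \<noteq> {}" using neq by auto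
  then obtain w x where "w \<in> V" "x \<in> V" "int (t w) = int (t x) + d"
    using uv by (auto simp: nbrs_def)
  then have d: "\<bar>d\<bar> \<le> int (span V t)"
    using tag_le_span[of w] tag_le_span[of x] by linarith
  define i where "i = nat (int L + int (span V t) + d)"
  have i: "int i = int L + int (span V t) + d" using d by (simp add: i_def)
  let ?f = "\<lambda>v. hist (extend D L C) v (L + 2 * span V t)"
  have "?f u ! i \<noteq> ?f v ! i"
    using hist_extend_nth[OF p uv(1) d i ne] hist_extend_nth[OF p uv(2) d i] ne uv(3) neq
    by (simp add: heard_eq_iff)
  then have "?f u \<noteq> ?f v" by auto
  then have "card (?c ` V) < card (?f ` V)"
    using uv take_hist_extend[OF p]
    by (intro card_image_less_refine[where h = "take L" and u = u and v = v] finite_V) auto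
  then show ?thesis using patient_extend[OF p] by blast
qed

lemma exists_patient_balanced:
  "\<exists>D L. patient D L \<and> L \<le> 1 + card V * (2 * span V t + 1) \<and> balanced (\<lambda>v. hist D v (L - 1))"
proof -
  \<comment> \<open>Each block spent on an unbalanced colouring adds a colour; at
    \<open>k = card V\<close> more than \<open>k\<close> colours are impossible.\<close>
  have "\<exists>D L. patient D L \<and> L \<le> 1 + k * (2 * span V t + 1) \<and>
    (balanced (\<lambda>v. hist D v (L - 1)) \<or> k < card ((\<lambda>v. hist D v (L - 1)) ` V))" for k
  proof (induction k)
    case 0
    have "patient (\<lambda>_. Listen) 1" by (simp add: patient_def)
    moreover have "0 < card ((\<lambda>v. hist (\<lambda>_. Listen) v (1 - 1)) ` V)"
      using finite_V V_nonempty by (simp add: card_gt_0_iff)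
    ultimately show ?case by (intro exI[of _ "\<lambda>_. Listen"] exI[of _ 1]) simp
  next
    case (Suc k)
    then obtain D L where p: "patient D L" and L: "L \<le> 1 + k * (2 * span V t + 1)"
      and alt: "balanced (\<lambda>v. hist D v (L - 1)) \<or> k < card ((\<lambda>v. hist D v (L - 1)) ` V)"
      by blast
    show ?case
    proof (cases "balanced (\<lambda>v. hist D v (L - 1))")
      case True
      moreover have "L \<le> 1 + Suc k * (2 * span V t + 1)" using L by simp
      ultimately show ?thesis using p by blast
    next
      case False
      with unbalanced_extend[OF p] obtain D' where D': "patient D' (L + 2 * span V t + 1)"
        "card ((\<lambda>v. hist D v (L - 1)) ` V) < card ((\<lambda>v. hist D' v (L + 2 * span V t)) ` V)"
        by blast
      with False alt have "Suc k < card ((\<lambda>v. hist D' v (L + 2 * span V t + 1 - 1)) ` V)" by simp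
      moreover have "L + 2 * span V t + 1 \<le> 1 + Suc k * (2 * span V t + 1)" using L by simp
      ultimately show ?thesis using D'(1) by blast
    qed
  qed
  from this[of "card V"] show ?thesis
    using card_image_le[OF finite_V] by (meson leD)
qed

section \<open>Termination\<close>

text \<open>Termination falls in local round \<open>L\<close>, whose entry is still recorded: final
  histories have \<open>Suc L\<close> entries, the first \<open>L\<close> of which are the
  colour.\<close>

definition stop_after :: "nat \<Rightarrow> drip \<Rightarrow> drip" where
  "stop_after L D H = (if L \<le> length H then Terminate else D H)"

fun stopped :: "nat \<Rightarrow> nstate \<Rightarrow> nstate" where
  "stopped L Asleep = Asleep"
| "stopped L (Active w H) = (if length H \<le> L then Active w H else Done w (take (Suc L) H))"
| "stopped L (Done w H) = Done w H"

text \<open>A patient protocol listens at all lengths from \<open>L\<close> on, so stopping there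
  silences nobody.\<close>

lemma msg_of_stopped:
  assumes "patient D L"
  shows "msg_of (stop_after L D) (stopped L s) = msg_of D s"
proof (cases s)
  case (Active w H)
  have "D H = Listen" if "L \<le> length H"
    using assms that unfolding patient_def by (metis add_lessD1 leD)
  then show ?thesis using Active by (simp add: msg_of_def stop_after_def)
qed (auto simp: msg_of_def)

lemma reception_stopped:
  assumes "patient D L" and "\<And>w. w \<in> V \<Longrightarrow> s' w = stopped L (s w)"
  shows "reception V E (stop_after L D) s' v = reception V E D s v"
proof -
  have m: "msg_of (stop_after L D) (s' w) = msg_of D (s w)" if "w \<in> V" for w
    using msg_of_stopped[OF assms(1)] assms(2)[OF that] by simp
  then have "transmitters (stop_after L D) s' v = transmitters D s v"
    by (auto simp: transmitters_def)
  \<comment> \<open>The two state functions are related only on \<open>V\<close>, so the sole sender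
    has to be located there.\<close>
  moreover have "(THE u. u \<in> transmitters D s v) \<in> V" if one: "card (transmitters D s v) = 1"
  proof -
    obtain u where u: "transmitters D s v = {u}" using one by (rule card_1_singletonE)
    then have "u \<in> V" unfolding transmitters_def by blast
    with u show ?thesis by simp
  qed
  ultimately show ?thesis using m by (simp add: reception_eq)
qed

lemma run_stopped:
  assumes p: "patient D L"
  shows "v \<in> V \<Longrightarrow> run V E t (stop_after L D) r v = stopped L (run V E t D r v)"
proof (induction r arbitrary: v)
  case 0
  have "L > 0" using p by (simp add: patient_def)
  then show ?case by (simp add: step_spontaneous transmitters_def)
next
  case (Suc r)
  have rec: "reception V E (stop_after L D) (run V E t (stop_after L D) r) v
      = reception V E D (run V E t D r) v"
    using reception_stopped[OF p] Suc.IH by blast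
  have L: "L > 0" using p by (simp add: patient_def)
  show ?case
  proof (cases "t v \<le> r")
    case True
    let ?H = "hist D v (r - t v)"
    have run: "run V E t D r v = Active (t v) ?H"
      by (rule patient_run_hist[OF p Suc.prems True])
    have D: "D ?H \<noteq> Terminate" "L \<le> length ?H \<Longrightarrow> D ?H = Listen"
      using p unfolding patient_def by (metis action.distinct(3,5), metis add_lessD1 leD)
    have run': "run V E t (stop_after L D) r v = stopped L (Active (t v) ?H)"
      using Suc run by simp
    have stop: "stop_after L D ?H = (if L \<le> length ?H then Terminate else D ?H)"
      by (simp add: stop_after_def)
    show ?thesis
    proof (cases "length ?H \<le> L")
      case True
      then show ?thesis using D rec run run' stop
        by (auto simp: step_def Let_def split: action.splits)
    next
      case False
      then show ?thesis using D rec run run'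
        by (auto simp: step_def Let_def split: action.splits)
    qed
  next
    case False
    then have "run V E t D r v = Asleep" using patient_run_Asleep[OF p Suc.prems] by simp
    then show ?thesis using Suc rec L
      by (auto simp: step_def Let_def split: hentry.splits)
  qed
qed

lemma run_stop_after_Done:
  assumes p: "patient D L" and v: "v \<in> V"
  shows "run V E t (stop_after L D) (t v + L) v = Done (t v) (hist D v L)"
  using run_stopped[OF p v, of "t v + L"] patient_run_hist[OF p v, of "t v + L"] length_hist[OF p v, of L]
  by simp

section \<open>Election from a balanced history colouring\<close>

lemma feasible_fast_election:
  assumes "feasible V E t"
  shows "\<exists>D f. dedicated_LE V E t D f \<and>
    (\<forall>v \<in> V. done_round V E t D v \<le> 3 * (card V)\<^sup>2 * (span V t + 1))"
proof -
  obtain D0 f0 where LE0: "dedicated_LE V E t D0 f0"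
    using assms by (auto simp: feasible_def)
  then obtain l where l: "{v \<in> V. f0 (final_hist V E t D0 v)} = {l}"
    by (auto simp: dedicated_LE_def card_1_singleton_iff)
  obtain D L where p: "patient D L" and L: "L \<le> 1 + card V * (2 * span V t + 1)"
    and bal: "balanced (\<lambda>v. hist D v (L - 1))"
    using exists_patient_balanced by blast
  have Lpos: "L > 0" using p by (simp add: patient_def)
  let ?D = "stop_after L D"
  have fin: "final_hist V E t ?D v = hist D v L" if "v \<in> V" for v
    using final_hist_eqI[OF run_stop_after_Done[OF p that]] .
  \<comment> \<open>Equal final histories give equal colours; by balance \<open>v\<close> then ends
    the given algorithm with the history of its leader \<open>l\<close> and is elected too.\<close>
  have uniq: "v = l" if v: "v \<in> V" and eq: "hist D v L = hist D l L" for v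
  proof -
    have lV: "l \<in> V" using l by blast
    have "hist D v (L - 1) = hist D l (L - 1)"
      using take_hist[OF p v, of "L - 1" L] take_hist[OF p lV, of "L - 1" L] eq by simp
    then have "final_hist V E t D0 v = final_hist V E t D0 l"
      using LE0 v lV by (intro balanced_final_hist_eq[OF bal]) (auto simp: dedicated_LE_def)
    moreover have "f0 (final_hist V E t D0 l)" using l by blast
    ultimately have "v \<in> {v \<in> V. f0 (final_hist V E t D0 v)}" using v by simp
    then show "v = l" unfolding l by simp
  qed
  have "{v \<in> V. final_hist V E t ?D v = hist D l L} = {l}"
    using uniq fin l by auto
  moreover have "terminates V E t ?D v" if "v \<in> V" for v
    using run_stop_after_Done[OF p that] unfolding terminates_def by blast
  ultimately have "dedicated_LE V E t ?D (\<lambda>H. H = hist D l L)"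
    by (simp add: dedicated_LE_def)
  moreover have "done_round V E t ?D v \<le> 3 * (card V)\<^sup>2 * (span V t + 1)" if v: "v \<in> V" for v
  proof -
    have n: "card V \<ge> 1" using v finite_V by (metis One_nat_def Suc_leI card_gt_0_iff empty_iff)
    have "done_round V E t ?D v = L"
      using fin[OF v] length_hist[OF p v, of L] by (simp add: done_round_def)
    \<comment> \<open>The initial 1 is absorbed into \<open>card V\<close>, which leaves
      \<open>card V * (2 * span V t + 2)\<close> and yields the constant 3.\<close>
    also have "\<dots> \<le> card V + card V * (2 * span V t + 1)" using L n by simp
    also have "\<dots> \<le> card V * (3 * (span V t + 1))" by (simp add: algebra_simps)
    also have "\<dots> \<le> (card V)\<^sup>2 * (3 * (span V t + 1))"
      using n by (intro mult_right_mono) (simp_all add: power2_eq_square)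
    finally show ?thesis by (simp only: ac_simps)
  qed
  ultimately show ?thesis by blast
qed

end

text \<open>The factor \<open>span V t + 1\<close> covers span 0, where a bound of 0 would fail
  since no node terminates before local round 1; for positive span it is at most
  \<open>2 * span V t\<close>.\<close>

theorem theorem1:
  shows "\<exists>c::nat. \<forall>V E t. configuration V E t \<and> feasible V E t \<longrightarrow>
           (\<exists>D f. dedicated_LE V E t D f \<and>
              (\<forall>v\<in>V. done_round V E t D v \<le> c * (card V)\<^sup>2 * (span V t + 1)))"
proof (intro exI[of _ 3] allI impI)
  fix V E t assume "configuration V E t \<and> feasible V E t"
  then interpret radio_network V E t by unfold_locales simp
  show "\<exists>D f. dedicated_LE V E t D f \<and>
      (\<forall>v\<in>V. done_round V E t D v \<le> 3 * (card V)\<^sup>2 * (span V t + 1))"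
    using \<open>configuration V E t \<and> feasible V E t\<close> by (intro feasible_fast_election) simp
qed

end
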